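(* Let $t$ be a positive integer, let $C$ be an $\mathbb{F}_q$-$[n\times m,k]$ rank-metric code, let $\mathcal{M}=\mathcal{M}[C]$ and let $U\le E=\mathbb{F}_q^n$. Then \[ \bigl|\{(X_1,\ldots,X_t)\in C^t : \textstyle\sum_{i=1}^t \operatorname{supp}(X_i)=U\}\bigr| = \mathbb{P}(\mathcal{M}.U;q^{t}). \]
   Context: $q$ is a prime power, $E=\mathbb{F}_q^n$, and $\mathcal{L}(E)$ is the lattice of $\mathbb{F}_q$-subspaces of $E$; its Möbius function is $\mu(V,W)=(-1)^{d}q^{\binom{d}{2}}$ with $d=\dim W-\dim V$ if $V\le W$, and $0$ otherwise. For $U\le E$, $U^\perp$ is the orthogonal complement with respect to the standard dot product. An $\mathbb{F}_q$-$[n\times m,k]$ rank-metric code is a $k$-dimensional $\mathbb{F}_q$-subspace $C\subseteq\mathbb{F}_q^{n\times m}$. For $X\in\mathbb{F}_q^{n\times m}$, $\operatorname{supp}(X)$ is the column space of $X$ (a subspace of $\mathbb{F}_q^n$). For $U\le E$ set $C_U=\{X\in C:\operatorname{supp}(X)\le U^\perp\}$ and $\rho(U)=k-\dim_{\mathbb{F}_q}C_U$; $\mathcal{M}[C]=(\mathcal{L}(E),\rho)$. For $X\le Y$, $\mathcal{M}([X,Y])$ is the interval $[X,Y]$ with weight $T\mapsto\rho(T)-\rho(X)$, with characteristic polynomial $\mathbb{P}(\mathcal{M}([X,Y]);z)=\sum_{A\in[X,Y]}\mu(X,A)z^{\rho(Y)-\rho(A)}$. The contraction to $U$ is $\mathcal{M}.U=\mathcal{M}([U^\perp,E])$.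 *)

theory Defs
  imports "HOL-Analysis.Analysis" "HOL-Computational_Algebra.Polynomial"
begin

text \<open>
  The field with \<open>q\<close> elements is an arbitrary type \<open>'a\<close> of classes \<open>field\<close> and \<open>finite\<close>,
  with \<open>q = CARD('a)\<close>. The space \<open>E\<close> is \<open>'a ^ 'n\<close> and an \<open>n \<times> m\<close> matrix is an element of
  \<open>'a ^ 'm ^ 'n\<close>, where \<open>n = CARD('n)\<close> and \<open>m = CARD('m)\<close>.
  A sum of subspaces is their elementwise sum as sets (\<open>Set_Algebras\<close>).
\<close>

definition matrix_smult :: "'a::field \<Rightarrow> 'a ^ 'm ^ 'n \<Rightarrow> 'a ^ 'm ^ 'n" where
  "matrix_smult c X = (\<chi> i j. c * X $ i $ j)"

interpretation matsp: vector_space "matrix_smult :: 'a::field \<Rightarrow> 'a ^ 'm ^ 'n \<Rightarrow> 'a ^ 'm ^ 'n"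
  by unfold_locales (simp_all add: matrix_smult_def vec_eq_iff algebra_simps)

interpretation matsp: finite_dimensional_vector_space
  "matrix_smult :: 'a::{field,finite} \<Rightarrow> 'a ^ 'm ^ 'n \<Rightarrow> 'a ^ 'm ^ 'n"
  "matsp.extend_basis {}"
  by unfold_locales
    (simp_all add: matsp.independent_extend_basis matsp.span_extend_basis matsp.independent_empty)

definition rank_metric_code :: "('a::{field,finite} ^ 'm ^ 'n) set \<Rightarrow> nat \<Rightarrow> bool" where
  "rank_metric_code C k \<longleftrightarrow> matsp.subspace C \<and> matsp.dim C = k"

definition supp :: "'a::field ^ 'm ^ 'n \<Rightarrow> ('a ^ 'n) set" where
  "supp X = vec.span (columns X)"

definition orth_compl :: "('a::field ^ 'n) set \<Rightarrow> ('a ^ 'n) set" where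
  "orth_compl U = {v. \<forall>u\<in>U. (\<Sum>i\<in>UNIV. u $ i * v $ i) = 0}"

definition shortened_code ::
  "('a::{field,finite} ^ 'm ^ 'n) set \<Rightarrow> ('a ^ 'n) set \<Rightarrow> ('a ^ 'm ^ 'n) set" where
  "shortened_code C U = {X \<in> C. supp X \<subseteq> orth_compl U}"

definition code_weight ::
  "('a::{field,finite} ^ 'm ^ 'n) set \<Rightarrow> ('a ^ 'n) set \<Rightarrow> nat" where
  "code_weight C U = matsp.dim C - matsp.dim (shortened_code C U)"

lemma dim_shortened_code_le: "matsp.dim (shortened_code C U) \<le> matsp.dim C"
  by (rule matsp.dim_subset) (auto simp: shortened_code_def)

lemma code_weight_mono: "U \<subseteq> V \<Longrightarrow> code_weight C U \<le> code_weight C V"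
  unfolding code_weight_def
  by (intro diff_le_mono2 matsp.dim_subset)
    (auto simp: shortened_code_def orth_compl_def subset_iff)

text \<open>
  A weighted interval \<open>[X, Y]\<close> of the lattice of subspaces of \<open>E\<close>. The weight is a total
  function, but only its values on the interval are meaningful.
\<close>

record ('a, 'n) weighted_interval =
  lower :: "('a ^ 'n) set"
  upper :: "('a ^ 'n) set"
  weight :: "('a ^ 'n) set \<Rightarrow> nat"

definition elements :: "('a::{field,finite}, 'n::finite) weighted_interval \<Rightarrow> ('a ^ 'n) set set" where
  "elements M = {A. vec.subspace A \<and> lower M \<subseteq> A \<and> A \<subseteq> upper M}"

definition code_lattice ::
  "('a::{field,finite} ^ 'm ^ 'n) set \<Rightarrow> ('a, 'n) weighted_interval" where
  "code_lattice C = \<lparr>lower = {0}, upper = UNIV, weight = code_weight C\<rparr>"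

text \<open>
  The natural-number differences of weights below are never truncated for \<open>code_lattice C\<close>,
  see \<open>dim_shortened_code_le\<close> and \<open>code_weight_mono\<close>.
\<close>

definition restrict_to ::
  "('a, 'n::finite) weighted_interval \<Rightarrow> ('a ^ 'n) set \<Rightarrow> ('a ^ 'n) set \<Rightarrow> ('a, 'n) weighted_interval"
where
  "restrict_to M X Y = \<lparr>lower = X, upper = Y, weight = (\<lambda>T. weight M T - weight M X)\<rparr>"

definition contraction ::
  "('a::{field,finite}, 'n::finite) weighted_interval \<Rightarrow> ('a ^ 'n) set \<Rightarrow> ('a, 'n) weighted_interval"
where
  "contraction M U = restrict_to M (orth_compl U) UNIV"

text \<open>
  Closed form of the Moebius function of the lattice of subspaces of \<open>E\<close>; the Moebius function
  of an interval is its restriction.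
\<close>

definition moebius :: "('a::{field,finite} ^ 'n) set \<Rightarrow> ('a ^ 'n) set \<Rightarrow> int" where
  "moebius V W =
    (if V \<subseteq> W
     then let d = vec.dim W - vec.dim V in (- 1) ^ d * int CARD('a) ^ (d choose 2)
     else 0)"

definition characteristic_poly :: "('a::{field,finite}, 'n::finite) weighted_interval \<Rightarrow> int poly" where
  "characteristic_poly M =
    (\<Sum>A\<in>elements M. monom (moebius (lower M) A) (weight M (upper M) - weight M A))"

end

theory Submission
  imports Defs
begin

text \<open>
  The weight difference attached to \<open>A\<close> in the contraction is \<open>dim C\<^sub>A\<close>, so evaluating its monomial
  at \<open>q ^ t\<close> gives the number of tuples in \<open>C\<close> whose support sum \<open>S\<close> satisfies
  \<open>S \<le> A\<^sup>\<bottom>\<close>, that is, \<open>A \<le> S\<^sup>\<bottom>\<close>. After exchanging summations, a tuple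
  contributes the sum of \<open>\<mu>(U\<^sup>\<bottom>, A)\<close> over \<open>A\<close> in \<open>[U\<^sup>\<bottom>, S\<^sup>\<bottom>]\<close>, which is
  \<open>1\<close> if \<open>S = U\<close> and \<open>0\<close> otherwise.

  That the closed form of \<open>\<mu>\<close> sums to zero over a proper interval \<open>[V, W]\<close> follows by induction from a
  hyperplane \<open>H\<close> of \<open>W\<close> containing \<open>V\<close>: each \<open>B\<close> in \<open>[V, H]\<close> equals \<open>A \<inter> H\<close> for exactly
  \<open>q ^ (dim H - dim B)\<close> subspaces \<open>A \<le> W\<close> not below \<open>H\<close>, so the sum over \<open>[V, W]\<close> is
  \<open>1 - q ^ (dim H - dim V)\<close> times the sum over \<open>[V, H]\<close>.
\<close>

section \<open>Cardinality of subspaces over a finite field\<close>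

text \<open>Each new basis vector \<open>x\<close> multiplies the count by the number of scalars,
  because every vector of the larger span is \<open>scale c x + y\<close> for exactly one scalar
  \<open>c\<close> and one \<open>y\<close> in the old span.\<close>

lemma (in vector_space) card_span_independent:
  assumes "finite (UNIV :: 'a set)" "finite B" "independent B"
  shows "card (span B) = card (UNIV :: 'a set) ^ card B"
  using assms(2,3)
proof (induction B)
  case empty
  then show ?case by simp
next
  case (insert x B)
  have ind: "independent B" and x: "x \<notin> span B"
    using insert.prems insert.hyps independent_insert[of x B] by auto
  let ?f = "\<lambda>(c, y). scale c x + y"
  have inj: "inj_on ?f (UNIV \<times> span B)"
  proof (rule inj_onI, clarsimp)
    fix c y d z
    assume yz: "y \<in> span B" "z \<in> span B" and eq: "scale c x + y = scale d x + z"
    have "scale (c - d) x = z - y"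
      using eq by (simp add: scale_left_diff_distrib algebra_simps)
    then have "scale (c - d) x \<in> span B"
      using yz by (simp add: span_diff)
    then have "c = d"
      using x span_scale[of "scale (c - d) x" B "inverse (c - d)"]
      by (cases "c = d") auto
    with eq show "c = d \<and> y = z" by simp
  qed
  have "span (insert x B) = ?f ` (UNIV \<times> span B)"
  proof (intro set_eqI iffI)
    fix v assume "v \<in> span (insert x B)"
    then obtain c where "v - scale c x \<in> span B"
      by (auto simp: span_insert)
    then show "v \<in> ?f ` (UNIV \<times> span B)"
      by (intro image_eqI[of _ _ "(c, v - scale c x)"]) auto
  next
    fix v assume "v \<in> ?f ` (UNIV \<times> span B)"
    then show "v \<in> span (insert x B)"
      by (auto simp: span_insert) (metis add_diff_cancel_left')
  qed
  then have "card (span (insert x B)) = card (UNIV :: 'a set) * card (span B)"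
    using inj by (simp add: card_image card_cartesian_product)
  then show ?case
    using insert ind by simp
qed

lemma (in finite_dimensional_vector_space) card_subspace:
  assumes "finite (UNIV :: 'a set)" "subspace S"
  shows "card S = card (UNIV :: 'a set) ^ dim S"
proof -
  obtain B where B: "B \<subseteq> S" "independent B" "S \<subseteq> span B" "card B = dim S"
    using basis_exists by blast
  have "span B = S"
    using B assms(2) by (simp add: span_subspace)
  then show ?thesis
    using card_span_independent[OF assms(1) finiteI_independent[OF B(2)] B(2)] B(4) by simp
qed

section \<open>Orthogonal complements\<close>

lemma subspace_orth_compl: "vec.subspace (orth_compl U)"
proof (rule vec.subspaceI)
  fix c v assume "v \<in> orth_compl U"
  then show "c *s v \<in> orth_compl U"
    by (simp add: orth_compl_def mult.left_commute flip: sum_distrib_left)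
qed (simp_all add: orth_compl_def distrib_left sum.distrib)

lemma subset_orth_compl_iff:
  fixes S A :: "('a::field ^ 'n) set"
  shows "S \<subseteq> orth_compl A \<longleftrightarrow> A \<subseteq> orth_compl S"
proof -
  have "A \<subseteq> orth_compl S" if S: "S \<subseteq> orth_compl A" for S A :: "('a ^ 'n) set"
  proof
    fix a assume "a \<in> A"
    with S have "(\<Sum>i\<in>UNIV. s $ i * a $ i) = 0" if "s \<in> S" for s
      using that by (auto simp: orth_compl_def mult.commute)
    then show "a \<in> orth_compl S"
      by (simp add: orth_compl_def)
  qed
  then show ?thesis by blast
qed

text \<open>Separation instead of a dimension count: a vector \<open>v\<close> outside
  \<open>S\<close> is detected by a linear map that vanishes on \<open>S\<close>, and the rows of
  its matrix lie in \<open>orth_compl S\<close>.\<close>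

lemma orth_compl_orth_compl:
  fixes S :: "('a::field ^ 'n) set"
  assumes S: "vec.subspace S"
  shows "orth_compl (orth_compl S) = S"
proof
  show "S \<subseteq> orth_compl (orth_compl S)"
    using subset_orth_compl_iff by blast
  show "orth_compl (orth_compl S) \<subseteq> S"
  proof
    fix v assume v: "v \<in> orth_compl (orth_compl S)"
    show "v \<in> S"
    proof (rule ccontr)
      assume "v \<notin> S"
      obtain B where B: "B \<subseteq> S" "vec.independent B" "S \<subseteq> vec.span B"
        using vec.basis_exists[of S] by metis
      have span: "vec.span B = S"
        using B S by (simp add: vec.span_subspace)
      have "vec.independent (insert v B)"
        using B \<open>v \<notin> S\<close> span by (simp add: vec.independent_insertI)
      \<comment> \<open>The value \<open>1\<close> at \<open>v\<close> is the all-ones vector; any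
        nonzero vector would do.\<close>
      then obtain f :: "'a ^ 'n \<Rightarrow> 'a ^ 'n"
        where f: "Vector_Spaces.linear (*s) (*s) f"
          and fB: "\<forall>x\<in>insert v B. f x = (if x = v then 1 else 0)"
        using vec.linear_independent_extend[of "insert v B" "\<lambda>x. if x = v then 1 else 0"] by blast
      have "f x = 0" if "x \<in> S" for x
        using vec.linear_eq_0_on_span[OF f, of B x] fB that span B(1) \<open>v \<notin> S\<close>
        by (metis insertCI subsetD)
      then have row: "(\<Sum>j\<in>UNIV. x $ j * matrix f $ i $ j) = 0" if "x \<in> S" for x i
        using matrix_works[OF f, of x] that
        by (simp add: matrix_vector_mult_def vec_eq_iff mult.commute)
      then have "matrix f $ i \<in> orth_compl S" for i
        by (simp add: orth_compl_def)
      then have "(\<Sum>j\<in>UNIV. matrix f $ i $ j * v $ j) = 0" for i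
        using v by (auto simp: orth_compl_def)
      then have "f v = 0"
        using matrix_works[OF f, of v] by (simp add: matrix_vector_mult_def vec_eq_iff)
      then show False
        using fB by (simp add: vec_eq_iff)
    qed
  qed
qed

lemma orth_compl_inj:
  "vec.subspace S \<Longrightarrow> vec.subspace T \<Longrightarrow> orth_compl S = orth_compl T \<longleftrightarrow> S = T"
  by (metis orth_compl_orth_compl)

section \<open>Subspaces and their intersection with a hyperplane\<close>

lemma mem_span_insert_subspace:
  "vec.subspace H \<Longrightarrow> y \<in> vec.span (insert x H) \<longleftrightarrow> (\<exists>c. y - c *s x \<in> H)"
  by (simp add: vec.span_insert vec.span_eq_iff[THEN iffD2])

text \<open>If \<open>b + c *s x\<close> lies in \<open>H\<close> with \<open>b\<close> in
  \<open>B\<close>, then so does \<open>c *s x\<close>, which forces \<open>c = 0\<close>. With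
  \<open>span_insert_Int_hyperplane_eq\<close> this makes adjoining \<open>x\<close> and
  intersecting with \<open>H\<close> mutually inverse.\<close>

lemma span_insert_Int_hyperplane:
  fixes H :: "('a::field ^ 'n) set"
  assumes "vec.subspace H" "vec.subspace B" "B \<subseteq> H" "x \<notin> H"
  shows "vec.span (insert x B) \<inter> H = B"
proof
  show "B \<subseteq> vec.span (insert x B) \<inter> H"
    using assms(3) by (auto intro: vec.span_base)
  show "vec.span (insert x B) \<inter> H \<subseteq> B"
  proof
    fix y assume "y \<in> vec.span (insert x B) \<inter> H"
    then obtain c where c: "y - c *s x \<in> B" and y: "y \<in> H"
      using mem_span_insert_subspace[OF assms(2), of y x] by blast
    have "c *s x \<in> H"
      using vec.subspace_diff[OF assms(1) y, of "y - c *s x"] c assms(3) by auto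
    then have "c = 0"
      using vec.subspace_scale[OF assms(1), of "c *s x" "inverse c"] assms(4)
      by (cases "c = 0") (auto simp: vector_smult_assoc)
    then show "y \<in> B" using c by simp
  qed
qed

lemma dim_insert_subspace:
  fixes B :: "('a::field ^ 'n) set"
  assumes "vec.subspace B" "x \<notin> B"
  shows "vec.dim (insert x B) = Suc (vec.dim B)"
  using assms vec.dim_insert[of x B] by (simp add: vec.span_eq_iff[THEN iffD2])

text \<open>Modulo \<open>H\<close>, both \<open>x\<close> and any \<open>y\<close> in
  \<open>A\<close> are multiples of \<open>h\<close>, and \<open>x\<close> is a nonzero one. Hence a
  multiple of \<open>x\<close> corrects \<open>y\<close> to an element of
  \<open>A \<inter> H\<close>.\<close>

lemma span_insert_Int_hyperplane_eq:
  fixes H :: "('a::field ^ 'n) set"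
  assumes "vec.subspace H" "vec.subspace A" "A \<subseteq> vec.span (insert h H)" "x \<in> A" "x \<notin> H"
  shows "vec.span (insert x (A \<inter> H)) = A"
proof
  show "vec.span (insert x (A \<inter> H)) \<subseteq> A"
    using assms by (intro vec.span_minimal) auto
  show "A \<subseteq> vec.span (insert x (A \<inter> H))"
  proof
    fix y assume y: "y \<in> A"
    obtain c where c: "y - c *s h \<in> H"
      using mem_span_insert_subspace[OF assms(1), of y h] y assms(3) by blast
    obtain d where d: "x - d *s h \<in> H"
      using mem_span_insert_subspace[OF assms(1), of x h] assms(3,4) by blast
    have "d \<noteq> 0" using d assms(5) by auto
    have "y - (c / d) *s x = (y - c *s h) - (c / d) *s (x - d *s h)"
      using \<open>d \<noteq> 0\<close> by (simp add: vec_eq_iff algebra_simps)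
    also have "\<dots> \<in> H"
      by (intro vec.subspace_diff[OF assms(1)] vec.subspace_scale[OF assms(1)] c d)
    finally have "y - (c / d) *s x \<in> A \<inter> H"
      using y assms(2,4) by (auto intro: vec.subspace_diff vec.subspace_scale)
    then show "y \<in> vec.span (insert x (A \<inter> H))"
      by (auto simp: vec.span_insert intro!: exI[of _ "c / d"] vec.span_base)
  qed
qed

text \<open>
  Double counting of the pairs \<open>(A, x)\<close> with \<open>x \<in> A - H\<close>: such a pair is determined by
  \<open>(A \<inter> H, x)\<close>. The factor \<open>q ^ (w - dim A)\<close> makes the number of pairs over \<open>A\<close>
  independent of \<open>A\<close>.
\<close>

lemma sum_subspaces_not_le_hyperplane:
  fixes V H :: "('a::{field,finite} ^ 'n) set" and f :: "nat \<Rightarrow> int"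
  assumes V: "vec.subspace V" and H: "vec.subspace H" and "V \<subseteq> H" and h: "h \<notin> H"
  defines "W \<equiv> vec.span (insert h H)"
  shows "(\<Sum>A | vec.subspace A \<and> V \<subseteq> A \<and> A \<subseteq> W \<and> \<not> A \<subseteq> H. f (vec.dim A)) =
    (\<Sum>B | vec.subspace B \<and> V \<subseteq> B \<and> B \<subseteq> H.
      int CARD('a) ^ (vec.dim H - vec.dim B) * f (Suc (vec.dim B)))"
    (is "sum _ ?\<A> = sum _ ?\<B>")
proof -
  let ?q = "int CARD('a)"
  let ?w = "Suc (vec.dim H)"
  let ?g = "\<lambda>A. ?q ^ (?w - vec.dim A) * f (vec.dim A)"
  \<comment> \<open>This is the cardinality of \<open>W - H\<close>; it is nonzero because
    \<open>q > 1\<close>, so it can be cancelled at the end.\<close>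
  let ?K = "?q ^ ?w - ?q ^ vec.dim H"
  have q: "?q > 1"
    using card_mono[of "UNIV :: 'a set" "{0, 1}"] by simp
  have W: "vec.subspace W" "vec.dim W = ?w" "H \<subseteq> W"
    unfolding W_def using dim_insert_subspace[OF H h] by (auto intro: vec.span_base)
  have cardq: "int (card S) = ?q ^ vec.dim S" if "vec.subspace S" for S :: "('a ^ 'n) set"
    using vec.card_subspace[OF finite that] by simp
  have card_diff: "int (card (S - T)) = ?q ^ vec.dim S - ?q ^ vec.dim T"
    if "vec.subspace S" "vec.subspace T" "T \<subseteq> S" for S T :: "('a ^ 'n) set"
    using that card_mono[OF finite that(3)] by (simp add: card_Diff_subset of_nat_diff cardq)
  have A: "int (card (A - H)) * ?q ^ (?w - vec.dim A) = ?K" if "A \<in> ?\<A>" for A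
  proof -
    from that obtain x where x: "x \<in> A" "x \<notin> H" by auto
    have sub: "vec.subspace A" "A \<subseteq> W" "vec.subspace (A \<inter> H)"
      using that H vec.subspace_inter by auto
    have "vec.span (insert x (A \<inter> H)) = A"
      using span_insert_Int_hyperplane_eq[OF H sub(1)] sub x unfolding W_def by blast
    then have d: "vec.dim A = Suc (vec.dim (A \<inter> H))"
      using dim_insert_subspace[OF sub(3), of x] x vec.dim_span by (metis IntD2)
    have "vec.dim (A \<inter> H) \<le> vec.dim H"
      by (intro vec.dim_subset) auto
    then obtain e where e: "vec.dim H = vec.dim (A \<inter> H) + e"
      using le_Suc_ex by blast
    have "A - H = A - A \<inter> H" by auto
    then have "int (card (A - H)) = ?q ^ vec.dim A - ?q ^ vec.dim (A \<inter> H)"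
      using card_diff[OF sub(1,3)] by simp
    then show ?thesis
      by (simp only: d e left_diff_distrib) (simp add: power_add)
  qed
  have "?K * (\<Sum>A\<in>?\<A>. f (vec.dim A)) = (\<Sum>A\<in>?\<A>. int (card (A - H)) * ?g A)"
    unfolding sum_distrib_left
    by (rule sum.cong[OF refl], subst A[symmetric]) (assumption, simp add: mult.assoc)
  also have "\<dots> = (\<Sum>A\<in>?\<A>. \<Sum>x\<in>A - H. ?g A)"
    by simp
  also have "\<dots> = (\<Sum>(A, x)\<in>Sigma ?\<A> (\<lambda>A. A - H). ?g A)"
    by (rule sum.Sigma) auto
  also have "\<dots> = (\<Sum>(B, x)\<in>?\<B> \<times> (W - H). ?g (vec.span (insert x B)))"
  proof (rule sum.reindex_bij_witness[where
        i = "\<lambda>(B, x). (vec.span (insert x B), x)" and j = "\<lambda>(A, x). (A \<inter> H, x)"], goal_cases)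
    case (1 a)
    then show ?case
      using span_insert_Int_hyperplane_eq[OF H, of "fst a" h "snd a"] by (auto simp: W_def)
  next
    case (2 a)
    then show ?case
      using H \<open>V \<subseteq> H\<close> vec.subspace_inter by auto
  next
    case (3 b)
    then show ?case
      using span_insert_Int_hyperplane[OF H, of "fst b" "snd b"] by auto
  next
    case (4 b)
    then obtain B x where b: "b = (B, x)" "vec.subspace B" "V \<subseteq> B" "B \<subseteq> H" "x \<in> W" "x \<notin> H"
      by auto
    have "vec.span (insert x B) \<subseteq> W"
      using b W by (intro vec.span_minimal) auto
    moreover have "insert x B \<subseteq> vec.span (insert x B)"
      by (rule vec.span_superset)
    ultimately show ?case
      using b by auto
  next
    case (5 a)
    then have "vec.span (insert (snd a) (fst a \<inter> H)) = fst a"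
      by (intro span_insert_Int_hyperplane_eq[OF H, of _ h]) (auto simp: W_def)
    then show ?case
      by (simp add: split_beta del: vec.dim_span)
  qed
  also have "\<dots> = (\<Sum>(B, x)\<in>?\<B> \<times> (W - H).
      ?q ^ (vec.dim H - vec.dim B) * f (Suc (vec.dim B)))"
  proof (intro sum.cong refl)
    fix p assume "p \<in> ?\<B> \<times> (W - H)"
    then have "vec.subspace (fst p)" "snd p \<notin> fst p" by auto
    then show "(case p of (B, x) \<Rightarrow> ?g (vec.span (insert x B))) =
        (case p of (B, x) \<Rightarrow> ?q ^ (vec.dim H - vec.dim B) * f (Suc (vec.dim B)))"
      by (simp add: split_beta dim_insert_subspace)
  qed
  also have "\<dots> = (\<Sum>B\<in>?\<B>. \<Sum>x\<in>W - H. ?q ^ (vec.dim H - vec.dim B) * f (Suc (vec.dim B)))"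
    by (rule sum.Sigma[symmetric]) auto
  also have "\<dots> = ?K * (\<Sum>B\<in>?\<B>. ?q ^ (vec.dim H - vec.dim B) * f (Suc (vec.dim B)))"
    using card_diff[OF W(1) H W(3)] W(2) by (simp add: sum_distrib_left)
  finally show ?thesis
    using q by simp
qed

section \<open>Moebius sums over intervals of subspaces\<close>

text \<open>A basis of \<open>V\<close> is extended to a basis of \<open>W\<close>, and one of the
  added vectors is removed to span \<open>H\<close>.\<close>

lemma exists_hyperplane_above:
  fixes V W :: "('a::field ^ 'n) set"
  assumes "vec.subspace V" "vec.subspace W" "V \<subset> W"
  obtains H h where "vec.subspace H" "V \<subseteq> H" "h \<notin> H" "W = vec.span (insert h H)"
proof -
  obtain B where B: "B \<subseteq> V" "vec.independent B" "V \<subseteq> vec.span B"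
    using vec.basis_exists[of V] by metis
  obtain D where D: "B \<subseteq> D" "D \<subseteq> W" "vec.independent D" "W \<subseteq> vec.span D"
    using vec.maximal_independent_subset_extend[of B W] B(1,2) assms(3) by auto
  have W: "W = vec.span D"
    using D assms(2) by (simp add: vec.span_subspace)
  have "vec.span B = V"
    using B assms(1) by (simp add: vec.span_subspace)
  then have "B \<noteq> D" using W assms(3) by auto
  then obtain h where h: "h \<in> D" "h \<notin> B" using D(1) by auto
  have "V \<subseteq> vec.span (D - {h})"
    using B(3) vec.span_mono[of B "D - {h}"] D(1) h by auto
  moreover have "h \<notin> vec.span (D - {h})"
    using D(3) h(1) by (auto simp: vec.dependent_def)
  moreover have "W = vec.span (insert h (vec.span (D - {h})))"
  proof -
    have "insert h (D - {h}) = D" using h by auto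
    then show ?thesis
      unfolding W using vec.span_insert[of h "D - {h}"] vec.span_insert[of h "vec.span (D - {h})"]
      by (simp add: vec.span_span)
  qed
  ultimately show ?thesis
    using that vec.subspace_span by blast
qed

lemma sum_moebius:
  fixes V W :: "('a::{field,finite} ^ 'n) set"
  assumes V: "vec.subspace V" and W: "vec.subspace W" and "V \<subseteq> W"
  shows "(\<Sum>A | vec.subspace A \<and> V \<subseteq> A \<and> A \<subseteq> W. moebius V A) = (if V = W then 1 else 0)"
  using W \<open>V \<subseteq> W\<close>
proof (induction "vec.dim W" arbitrary: W rule: less_induct)
  case less
  show ?case
  proof (cases "V = W")
    case True
    then have "{A. vec.subspace A \<and> V \<subseteq> A \<and> A \<subseteq> W} = {V}"
      using V by auto
    then show ?thesis
      using True by (simp add: moebius_def Let_def numeral_2_eq_2)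
  next
    case False
    then obtain H h where H: "vec.subspace H" "V \<subseteq> H" "h \<notin> H" "W = vec.span (insert h H)"
      using exists_hyperplane_above[OF V less.prems(1)] less.prems(2) by blast
    let ?q = "int CARD('a)"
    let ?\<B> = "{B. vec.subspace B \<and> V \<subseteq> B \<and> B \<subseteq> H}"
    let ?\<A> = "{A. vec.subspace A \<and> V \<subseteq> A \<and> A \<subseteq> W \<and> \<not> A \<subseteq> H}"
    define f where
      "f a = (- 1) ^ (a - vec.dim V) * ?q ^ ((a - vec.dim V) choose 2)" for a
    have f: "moebius V A = f (vec.dim A)" if "V \<subseteq> A" for A
      using that by (simp add: moebius_def f_def Let_def)
    have dimW: "vec.dim W = Suc (vec.dim H)"
      using dim_insert_subspace[OF H(1,3)] H(4) by simp
    have "H \<subseteq> W" using H(4) by (auto intro: vec.span_base)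
    then have "{A. vec.subspace A \<and> V \<subseteq> A \<and> A \<subseteq> W} = ?\<B> \<union> ?\<A>"
      by auto
    then have "(\<Sum>A | vec.subspace A \<and> V \<subseteq> A \<and> A \<subseteq> W. moebius V A) =
        (\<Sum>B\<in>?\<B>. f (vec.dim B)) + (\<Sum>A\<in>?\<A>. f (vec.dim A))"
      by (simp add: f, subst sum.union_disjoint) (auto simp: f)
    also have "(\<Sum>A\<in>?\<A>. f (vec.dim A)) =
        (\<Sum>B\<in>?\<B>. ?q ^ (vec.dim H - vec.dim B) * f (Suc (vec.dim B)))"
      unfolding H(4) by (rule sum_subspaces_not_le_hyperplane[OF V H(1-3)])
    also have "\<dots> = (\<Sum>B\<in>?\<B>. - (?q ^ (vec.dim H - vec.dim V)) * f (vec.dim B))"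
    proof (intro sum.cong refl)
      fix B assume "B \<in> ?\<B>"
      then have "vec.dim V \<le> vec.dim B" "vec.dim B \<le> vec.dim H"
        by (auto intro: vec.dim_subset)
      then obtain d e where "vec.dim B = vec.dim V + d" "vec.dim H = vec.dim V + d + e"
        by (metis le_Suc_ex)
      \<comment> \<open>Since \<open>Suc d choose 2 = (d choose 2) + d\<close>, raising the
        dimension by one costs the factor \<open>- (?q ^ d)\<close>. Together with
        \<open>?q ^ e\<close> this depends only on \<open>d + e\<close>, hence not on
        \<open>B\<close>.\<close>
      then show "?q ^ (vec.dim H - vec.dim B) * f (Suc (vec.dim B)) =
          - (?q ^ (vec.dim H - vec.dim V)) * f (vec.dim B)"
        by (simp add: f_def Suc_diff_le power_add numeral_2_eq_2)
    qed
    also have "(\<Sum>B\<in>?\<B>. f (vec.dim B)) + \<dots> =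
        (1 - ?q ^ (vec.dim H - vec.dim V)) * (\<Sum>B\<in>?\<B>. moebius V B)"
      by (simp add: f sum_distrib_left algebra_simps sum.distrib sum_negf sum_subtractf)
    \<comment> \<open>For \<open>V = H\<close> the first factor is \<open>1 - ?q ^ 0\<close>;
      otherwise the sum vanishes by induction.\<close>
    also have "\<dots> = 0"
      using less.hyps[of H] dimW H(1,2) by (cases "V = H") auto
    finally show ?thesis
      using False by simp
  qed
qed

section \<open>Sums of subspaces and supports\<close>

lemma subspace_sum_sets:
  fixes S :: "'i \<Rightarrow> ('a::field ^ 'n) set"
  assumes "\<And>i. i \<in> I \<Longrightarrow> vec.subspace (S i)"
  shows "vec.subspace (\<Sum>i\<in>I. S i)"
  using assms
proof (induction I rule: infinite_finite_induct)
  case (insert i I)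
  have "S i + sum S I = {x + y |x y. x \<in> S i \<and> y \<in> sum S I}"
    by (auto simp: set_plus_def)
  then show ?case
    using insert vec.subspace_sums[of "S i" "sum S I"] by simp
\<comment> \<open>For empty or infinite \<open>I\<close> the sum is the zero of set addition, which
  is \<open>{0}\<close>.\<close>
qed (simp_all add: set_zero vec.subspace_single_0)

text \<open>Every summand contains \<open>0\<close>, so it lies in the elementwise sum; conversely
  \<open>T\<close> is closed under addition.\<close>

lemma sum_sets_subset_iff:
  fixes S :: "'i \<Rightarrow> ('a::field ^ 'n) set"
  assumes "finite I" "\<And>i. i \<in> I \<Longrightarrow> vec.subspace (S i)" "vec.subspace T"
  shows "(\<Sum>i\<in>I. S i) \<subseteq> T \<longleftrightarrow> (\<forall>i\<in>I. S i \<subseteq> T)"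
  using assms(1,2)
proof (induction I)
  case empty
  then show ?case
    using vec.subspace_0[OF assms(3)] by simp
next
  case (insert i I)
  have 0: "0 \<in> S i" "0 \<in> sum S I"
    using insert.prems by (auto intro!: vec.subspace_0 subspace_sum_sets)
  have "S i + sum S I \<subseteq> T \<longleftrightarrow> S i \<subseteq> T \<and> sum S I \<subseteq> T"
  proof
    assume L: "S i + sum S I \<subseteq> T"
    show "S i \<subseteq> T \<and> sum S I \<subseteq> T"
    proof (intro conjI subsetI)
      fix x assume "x \<in> S i"
      then show "x \<in> T" using L 0 set_plus_intro[of x "S i" 0 "sum S I"] by auto
    next
      fix x assume "x \<in> sum S I"
      then show "x \<in> T" using L 0 set_plus_intro[of 0 "S i" x "sum S I"] by auto
    qed
  next
    assume "S i \<subseteq> T \<and> sum S I \<subseteq> T"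
    then show "S i + sum S I \<subseteq> T"
      using vec.subspace_add[OF assms(3)] by (auto elim!: set_plus_elim)
  qed
  then show ?case using insert by simp
qed

lemma subspace_supp: "vec.subspace (supp X)"
  by (simp add: supp_def)

lemma supp_subset_iff:
  assumes "vec.subspace T"
  shows "supp X \<subseteq> T \<longleftrightarrow> (\<forall>j. column j X \<in> T)"
proof -
  have "supp X \<subseteq> T \<longleftrightarrow> columns X \<subseteq> T"
    using vec.span_superset[of "columns X"] vec.span_minimal[OF _ assms, of "columns X"]
    unfolding supp_def by blast
  then show ?thesis by (auto simp: columns_def)
qed

section \<open>Shortened codes and weights\<close>

lemma subspace_shortened_code:
  fixes C :: "('a::{field,finite} ^ 'm ^ 'n) set"
  assumes "matsp.subspace C"
  shows "matsp.subspace (shortened_code C A)"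
proof -
  have "column j (0 :: 'a ^ 'm ^ 'n) = 0" "column j (X + Y) = column j X + column j Y"
    "column j (matrix_smult c X) = c *s column j X"
    for j c and X Y :: "'a ^ 'm ^ 'n"
    by (simp_all add: column_def matrix_smult_def vec_eq_iff)
  then show ?thesis
    using assms subspace_orth_compl[of A] unfolding matsp.subspace_def vec.subspace_def
    by (simp add: shortened_code_def supp_subset_iff[OF subspace_orth_compl])
qed

lemma orth_compl_UNIV: "orth_compl (UNIV :: ('a::field ^ 'n) set) = {0}"
proof -
  have "orth_compl {0 :: 'a ^ 'n} = UNIV"
    by (simp add: orth_compl_def)
  then show ?thesis
    using orth_compl_orth_compl[OF vec.subspace_single_0] by metis
qed

lemma dim_shortened_code_UNIV:
  fixes C :: "('a::{field,finite} ^ 'm ^ 'n) set"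
  shows "matsp.dim (shortened_code C UNIV) = 0"
proof -
  have "shortened_code C UNIV \<subseteq> {0}"
    by (auto simp: shortened_code_def orth_compl_UNIV supp_subset_iff[OF vec.subspace_single_0]
        column_def vec_eq_iff)
  then show ?thesis
    by (metis matsp.dim_eq_0)
qed

text \<open>The weight at \<open>UNIV\<close> is \<open>dim C\<close>, as only the zero matrix has
  support \<open>{0}\<close>. By monotonicity no subtraction truncates, so the weights at
  \<open>V\<close> cancel.\<close>

lemma weight_differences:
  assumes "V \<subseteq> A"
  shows "(code_weight C UNIV - code_weight C V) - (code_weight C A - code_weight C V) =
    matsp.dim (shortened_code C A)"
  using assms code_weight_mono[of V A C] code_weight_mono[of A UNIV C]
    dim_shortened_code_le[of C A]
  by (simp add: code_weight_def dim_shortened_code_UNIV)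

section \<open>Counting tuples by the sum of their supports\<close>

theorem theorem4p3:
  fixes C :: "('a::{field,finite} ^ 'm::finite ^ 'n::finite) set"
    and U :: "('a ^ 'n) set"
    and k t q :: nat
  assumes "q = CARD('a)"
    and "0 < t"
    and "rank_metric_code C k"
    and "vec.subspace U"
  shows "int (card {X \<in> {1..t} \<rightarrow>\<^sub>E C. (\<Sum>i = 1..t. supp (X i)) = U})
       = poly (characteristic_poly (contraction (code_lattice C) U)) (int q ^ t)"
proof -
  let ?V = "orth_compl U"
  let ?S = "\<lambda>X :: nat \<Rightarrow> 'a ^ 'm ^ 'n. \<Sum>i = 1..t. supp (X i)"
  let ?T = "{1..t} \<rightarrow>\<^sub>E C"
  let ?\<A> = "{A. vec.subspace A \<and> ?V \<subseteq> A}"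
  have C: "matsp.subspace C"
    using assms(3) by (simp add: rank_metric_code_def)
  have S: "vec.subspace (?S X)" for X
    by (intro subspace_sum_sets subspace_supp)
  have "finite ?T"
    by (intro finite_PiE) auto
  \<comment> \<open>By symmetry of orthogonality, \<open>A\<close> lies in the complement of the
    support sum exactly when every entry of the tuple lies in
    \<open>shortened_code C A\<close>.\<close>
  have count: "int q ^ (t * matsp.dim (shortened_code C A)) =
      (\<Sum>X\<in>?T. if A \<subseteq> orth_compl (?S X) then 1 else 0)" for A
  proof -
    have "{X \<in> ?T. A \<subseteq> orth_compl (?S X)} = {1..t} \<rightarrow>\<^sub>E shortened_code C A"
      by (simp add: set_eq_iff subset_orth_compl_iff[of A] sum_sets_subset_iff subspace_supp
          subspace_orth_compl shortened_code_def PiE_iff) blast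
    then have "card {X \<in> ?T. A \<subseteq> orth_compl (?S X)} = card (shortened_code C A) ^ t"
      by (simp add: card_PiE)
    also have "card (shortened_code C A) = q ^ matsp.dim (shortened_code C A)"
      using matsp.card_subspace[OF finite subspace_shortened_code[OF C]] assms(1) by simp
    finally show ?thesis
      using \<open>finite ?T\<close> by (simp add: sum.If_cases Int_def mult.commute flip: power_mult)
  qed
  have inner: "(\<Sum>A\<in>?\<A>. if A \<subseteq> orth_compl (?S X) then moebius ?V A else 0) =
      (if ?S X = U then 1 else 0)" for X
  proof -
    have "(\<Sum>A\<in>?\<A>. if A \<subseteq> orth_compl (?S X) then moebius ?V A else 0) =
        (\<Sum>A | vec.subspace A \<and> ?V \<subseteq> A \<and> A \<subseteq> orth_compl (?S X). moebius ?V A)"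
      by (simp add: sum.If_cases Int_def conj_assoc)
    also have "\<dots> = (if ?S X = U then 1 else 0)"
    proof (cases "?V \<subseteq> orth_compl (?S X)")
      case True
      \<comment> \<open>Complementation is injective on subspaces, so the interval is trivial
        exactly when the support sum equals \<open>U\<close>.\<close>
      then show ?thesis
        using sum_moebius[OF subspace_orth_compl subspace_orth_compl True]
          orth_compl_inj[OF S assms(4), of X] by auto
    next
      case False
      then have "{A. vec.subspace A \<and> ?V \<subseteq> A \<and> A \<subseteq> orth_compl (?S X)} = {}" "?S X \<noteq> U"
        by auto
      then show ?thesis by (simp only: sum.empty if_False)
    qed
    finally show ?thesis .
  qed
  have "poly (characteristic_poly (contraction (code_lattice C) U)) (int q ^ t) =
      (\<Sum>A\<in>?\<A>. moebius ?V A * int q ^ (t * matsp.dim (shortened_code C A)))"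
    using weight_differences[of ?V _ C]
    by (simp add: characteristic_poly_def contraction_def restrict_to_def code_lattice_def
        elements_def poly_sum poly_monom flip: power_mult)
  also have "\<dots> = (\<Sum>A\<in>?\<A>. \<Sum>X\<in>?T. if A \<subseteq> orth_compl (?S X) then moebius ?V A else 0)"
    unfolding count sum_distrib_left by (intro sum.cong refl) auto
  also have "\<dots> = (\<Sum>X\<in>?T. \<Sum>A\<in>?\<A>. if A \<subseteq> orth_compl (?S X) then moebius ?V A else 0)"
    by (rule sum.swap)
  also have "\<dots> = int (card {X \<in> ?T. ?S X = U})"
    unfolding inner using \<open>finite ?T\<close> by (simp add: sum.If_cases Int_def)
  finally show ?thesis by simp
qed

end
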